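(* Consider $F$ mapping $d$-variate random variables (distributions) $X$ to $\mathbb{R}$ as $$F(X)=\sum_{m=0}^\infty\ \sum_{\pi\in\Pi(d,m)}\mu_\pi(X)f_\pi,$$ and define, for integers $m\ge0$, $$\alpha_m=\max_{\pi\in\Pi(d,m)}|\mu_\pi(X)|,\qquad\beta_m=\sum_{\pi\in\Pi(d,m)}|f_\pi|,\qquad\gamma_m=\sum_{j=m}^\infty\alpha_j\beta_j.$$ Then, with $$k=\left\lfloor\tfrac12\log_2(\gamma_0)-\tfrac12\log_2\big(\gamma_{\lceil\sqrt{N/8}\rceil}\big)\right\rfloor,$$ the $N$-sample, $k$-times iterated bootstrap has bias $$\left|(\mathrm{Id}-\mathcal{S})^{k+1}F(X)\right|\le\sqrt{16\,\gamma_0\,\gamma_{\lceil\sqrt{N/8}\rceil}}.$$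
   Context: Distributions $X$ are probability measures on $\mathbb{R}^d$ with all moments finite, and the $f_\pi$ are real coefficients. $\Pi(d,m)$ is the set of multiset partitions of size-$m$ multisets with elements in $\{1,\dots,d\}$, i.e. the set of multisets $[s_1,\dots,s_i]$, $i\in\mathbb{N}$, whose members $s_j$ are (nonempty) multisets with elements in $\{1,\dots,d\}$ and $\sum_j\#s_j=m$ (cardinalities counted with multiplicity; $\Pi(d,0)$ contains only the empty one). For $\pi=[s_1,\dots,s_i]\in\Pi(d,m)$, $\mu_\pi(X)=\prod_{j=1}^i\mathbb{E}_{x\sim X}\big[\prod_{l\in s_j}x_l\big]$ with products over $s_j$ taken with multiplicity (e.g. $\pi=[[1,1,5],[1,6],[1,6]]$ gives $\mu_\pi=\mathbb{E}[x_1x_1x_5]\,\mathbb{E}[x_1x_6]\,\mathbb{E}[x_1x_6]$). $Y\sim_N X$ denotes $N$ independent samples from $X$, identified with their empirical distribution. The resampling operator is $(\mathcal{S}G)(X)=\mathbb{E}_{Y\sim_N X}[G(Y)]$. The $k$-times iterated bootstrap for target $F$ is $\mathcal{B}^kF=\sum_{i=0}^k(\mathrm{Id}-\mathcal{S})^iF$, and the absolute value of the bias of $(\mathcal{B}^kF)(Y)$, $Y\sim_N X$, as an estimator of $F(X)$ is $|(\mathrm{Id}-\mathcal{S})^{k+1}F(X)|$.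
   Formalization: The formal version assumes γ_0 is finite, γ_{⌈√(N/8)⌉} > 0, and that the series for F converges absolutely under the iterated expectations S^i at X for i ≤ k+1; without the last the bound can fail (odd moments of X zero, X not symmetric). *)

theory Defs
  imports "HOL-Probability.Probability" "HOL-Library.Multiset"
begin

text \<open>The index set \<open>{1,\<dots>,d}\<close> is rendered as a finite type \<open>'d\<close> with \<open>d = CARD('d)\<close>. The requirement
  on integrability says that all mixed moments exist.\<close>

definition is_distribution :: "(real ^ 'd::finite) measure \<Rightarrow> bool" where
  "is_distribution X \<longleftrightarrow> prob_space X \<and> sets X = sets borel \<and>
     (\<forall>s :: 'd multiset. integrable X (\<lambda>x. \<Prod>l\<in>#s. x $ l))"

definition mpartitions :: "nat \<Rightarrow> 'd multiset multiset set" where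
  "mpartitions m = {\<pi>. {#} \<notin># \<pi> \<and> (\<Sum>s\<in>#\<pi>. size s) = m}"

definition moment :: "'d multiset multiset \<Rightarrow> (real ^ 'd::finite) measure \<Rightarrow> real" where
  "moment \<pi> X = (\<Prod>s\<in>#\<pi>. \<integral>x. (\<Prod>l\<in>#s. x $ l) \<partial>X)"

definition moment_series ::
    "('d multiset multiset \<Rightarrow> real) \<Rightarrow> (real ^ 'd::finite) measure \<Rightarrow> real" where
  "moment_series f X = (\<Sum>m. \<Sum>\<pi>\<in>mpartitions m. moment \<pi> X * f \<pi>)"

definition abs_moment_series ::
    "('d multiset multiset \<Rightarrow> real) \<Rightarrow> (real ^ 'd::finite) measure \<Rightarrow> ennreal" where
  "abs_moment_series f X = (\<Sum>m. ennreal \<bar>\<Sum>\<pi>\<in>mpartitions m. moment \<pi> X * f \<pi>\<bar>)"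

definition alpha :: "(real ^ 'd::finite) measure \<Rightarrow> nat \<Rightarrow> real" where
  "alpha X m = Max ((\<lambda>\<pi>. \<bar>moment \<pi> X\<bar>) ` mpartitions m)"

definition beta :: "('d::finite multiset multiset \<Rightarrow> real) \<Rightarrow> nat \<Rightarrow> real" where
  "beta f m = (\<Sum>\<pi>\<in>mpartitions m. \<bar>f \<pi>\<bar>)"

definition gamma ::
    "(real ^ 'd::finite) measure \<Rightarrow> ('d multiset multiset \<Rightarrow> real) \<Rightarrow> nat \<Rightarrow> real" where
  "gamma X f m = (\<Sum>j. alpha X (m + j) * beta f (m + j))"

definition sample :: "nat \<Rightarrow> 'a measure \<Rightarrow> (nat \<Rightarrow> 'a) measure" where
  "sample N X = Pi\<^sub>M {..<N} (\<lambda>_. X)"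

definition empirical :: "nat \<Rightarrow> (nat \<Rightarrow> real ^ 'd::finite) \<Rightarrow> (real ^ 'd) measure" where
  "empirical N y = distr (uniform_count_measure {..<N}) borel y"

definition resample ::
    "nat \<Rightarrow> ((real ^ 'd::finite) measure \<Rightarrow> real) \<Rightarrow> (real ^ 'd) measure \<Rightarrow> real" where
  "resample N G X = (\<integral>y. G (empirical N y) \<partial>sample N X)"

text \<open>The same operator on \<open>[0,\<infinity>]\<close>-valued functionals, where the expectation always exists. It is
  used to say that an iterated expectation of a series converges absolutely: the Bochner integral
  and \<open>suminf\<close> in \<open>resample\<close> and \<open>moment_series\<close> have default values otherwise.\<close>

definition nn_resample ::
    "nat \<Rightarrow> ((real ^ 'd::finite) measure \<Rightarrow> ennreal) \<Rightarrow> (real ^ 'd) measure \<Rightarrow> ennreal" where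
  "nn_resample N G X = (\<integral>\<^sup>+y. G (empirical N y) \<partial>sample N X)"

definition id_minus_resample ::
    "nat \<Rightarrow> ((real ^ 'd::finite) measure \<Rightarrow> real) \<Rightarrow> (real ^ 'd) measure \<Rightarrow> real" where
  "id_minus_resample N G X = G X - resample N G X"

definition iterated_bootstrap ::
    "nat \<Rightarrow> nat \<Rightarrow> ((real ^ 'd::finite) measure \<Rightarrow> real) \<Rightarrow> (real ^ 'd) measure \<Rightarrow> real" where
  "iterated_bootstrap N k F X = (\<Sum>i\<le>k. (id_minus_resample N ^^ i) F X)"

definition bootstrap_bias ::
    "nat \<Rightarrow> nat \<Rightarrow> ((real ^ 'd::finite) measure \<Rightarrow> real) \<Rightarrow> (real ^ 'd) measure \<Rightarrow> real" where
  "bootstrap_bias N k F X =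
     (\<integral>y. iterated_bootstrap N k F (empirical N y) \<partial>sample N X) - F X"

end

theory Submission
  imports Defs
begin

text \<open>Resampling replaces each factor of a moment \<open>\<mu>\<^sub>\<pi>\<close> by an average over the samples, so \<open>S \<mu>\<^sub>\<pi>\<close>
  is the average of \<open>\<mu>\<^sub>\<rho>\<close> over all maps from the factors of \<open>\<pi>\<close> to the \<open>N\<close> samples, where \<open>\<rho>\<close> merges
  the factors with a common sample. The order \<open>m\<close> is preserved, and injective maps give \<open>\<mu>\<^sub>\<pi>\<close>
  back. On moments of order \<open>m\<close>, in the \<open>l\<^sup>1\<close> norm of the coefficients, \<open>Id - S\<close> therefore has norm at
  most 2, and at most 1/4 if \<open>8 m\<^sup>2 \<le> N\<close>, because then at most 1/8 of the maps are not injective.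
  Hence the bias is at most \<open>(1/4) ^ (k+1) * \<gamma>\<^sub>0 + 2 ^ (k+1) * \<gamma>\<^sub>M\<close>, which the choice of \<open>k\<close> balances.\<close>

subsection \<open>Resampling a moment\<close>

definition mmonom :: "'d multiset \<Rightarrow> real ^ 'd::finite \<Rightarrow> real" where
  "mmonom s x = (\<Prod>l\<in>#s. x $ l)"

lemma mmonom_sum: "mmonom (\<Sum>j\<in>J. g j) x = (\<Prod>j\<in>J. mmonom (g j) x)"
  by (induction J rule: infinite_finite_induct) (auto simp: mmonom_def)

lemma borel_measurable_mmonom [measurable]:
  fixes s :: "'d::finite multiset"
  shows "mmonom s \<in> borel_measurable borel"
proof (induction s)
  case empty
  show ?case by (simp add: mmonom_def)
next
  case (add l s)
  have "mmonom (add_mset l s) = (\<lambda>x. x $ l * mmonom s x)" by (auto simp: mmonom_def)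
  moreover have "(\<lambda>x :: real ^ 'd. x $ l) \<in> borel_measurable borel"
    by (intro borel_measurable_continuous_onI continuous_on_component continuous_on_id)
  ultimately show ?case using add by simp
qed

lemma moment_mmonom: "moment \<pi> X = (\<Prod>s\<in>#\<pi>. \<integral>x. mmonom s x \<partial>X)"
  by (simp add: moment_def mmonom_def)

lemma is_distributionD:
  assumes "is_distribution X"
  shows "prob_space X" "sets X = sets borel" "integrable X (mmonom s)"
  using assms by (auto simp: is_distribution_def mmonom_def[abs_def])

lemma sets_sample:
  assumes "is_distribution X"
  shows "sets (sample N X) = sets (Pi\<^sub>M {..<N} (\<lambda>_. borel))"
  unfolding sample_def using is_distributionD(2)[OF assms] by (intro sets_PiM_cong) auto

lemma borel_measurable_uniform_count_measure:
  fixes y :: "nat \<Rightarrow> real ^ 'd::finite"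
  shows "y \<in> borel_measurable (uniform_count_measure {..<N})"
  by (auto simp: measurable_def sets_uniform_count_measure space_uniform_count_measure)

lemma integral_empirical:
  assumes "h \<in> borel_measurable borel"
  shows "(\<integral>x. h x \<partial>empirical N y) = (\<Sum>n<N. h (y n)) / real N"
  unfolding empirical_def using assms
  by (subst integral_distr[OF borel_measurable_uniform_count_measure]) (auto simp: integral_uniform_count_measure)

text \<open>Resampling stays within the distributions, so whatever holds for all of them may be used
  again under the integral of the next resampling step. No measurability of \<open>y\<close> is
  needed since the index space is discrete; \<open>N \<ge> 1\<close> excludes the empty sample,
  whose measure has mass 0.\<close>

lemma is_distribution_empirical:
  assumes "N \<ge> 1"
  shows "is_distribution (empirical N y)"
proof -
  have "integrable (empirical N y) (\<lambda>x. \<Prod>l\<in>#s. x $ l)" for s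
    using borel_measurable_mmonom[of s] unfolding empirical_def mmonom_def[abs_def]
    by (subst integrable_distr_eq[OF borel_measurable_uniform_count_measure])
       (auto simp: uniform_count_measure_def integrable_point_measure_finite)
  moreover have "prob_space (empirical N y)"
    using assms unfolding empirical_def
    by (intro prob_space.prob_space_distr prob_space_uniform_count_measure borel_measurable_uniform_count_measure)
       (auto simp: lessThan_empty_iff)
  ultimately show ?thesis
    by (auto simp: is_distribution_def empirical_def)
qed

lemma moment_empirical:
  "moment \<pi> (empirical N y) = (\<Prod>s\<in>#\<pi>. (\<Sum>n<N. mmonom s (y n)) / real N)"
  by (simp add: moment_mmonom integral_empirical)

lemma moment_mset: "moment (mset ss) X = (\<Prod>j<length ss. \<integral>x. mmonom (ss ! j) x \<partial>X)"
  unfolding moment_mmonom mset_map[symmetric] prod_mset_prod_list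
  by (simp add: prod.list_conv_set_nth atLeast0LessThan)

text \<open>An empty factor is the monomial 1, which has expectation 1 under a probability
  measure.\<close>

lemma moment_filter_nonempty:
  assumes "prob_space X"
  shows "moment (filter_mset (\<lambda>s. s \<noteq> {#}) \<pi>) X = moment \<pi> X"
proof -
  interpret prob_space X by fact
  have "expectation (mmonom {#}) = 1" by (simp add: mmonom_def[abs_def] prob_space)
  then show ?thesis by (induction \<pi>) (simp_all add: moment_mmonom)
qed

text \<open>If the \<open>j\<close>-th factor of a moment is evaluated at the sample \<open>\<phi> j\<close>, then the factors that share
  a sample merge into one; the multisets of samples that no factor uses are dropped.\<close>

definition merge_factors :: "nat \<Rightarrow> 'd multiset list \<Rightarrow> (nat \<Rightarrow> nat) \<Rightarrow> 'd multiset multiset" where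
  "merge_factors N ss \<phi> = filter_mset (\<lambda>s. s \<noteq> {#})
     (image_mset (\<lambda>n. \<Sum>j\<in>{j\<in>{..<length ss}. \<phi> j = n}. ss ! j) (mset_set {..<N}))"

lemma moment_merge_factors:
  assumes "prob_space X"
  shows "moment (merge_factors N ss \<phi>) X =
    (\<Prod>n<N. \<integral>x. mmonom (\<Sum>j\<in>{j\<in>{..<length ss}. \<phi> j = n}. ss ! j) x \<partial>X)"
  unfolding merge_factors_def moment_filter_nonempty[OF assms]
  by (simp add: moment_mmonom image_mset.compositionality comp_def prod_unfold_prod_mset)

text \<open>Multiplying out the product of averages gives one term for each choice
  \<open>\<phi>\<close> of a sample per factor. Grouping the factors by their sample then writes
  each term as a product over samples, the form to which independence applies.\<close>

lemma moment_empirical_expand: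
  "moment (mset ss) (empirical N y) =
     (\<Sum>\<phi>\<in>{..<length ss} \<rightarrow>\<^sub>E {..<N}.
        \<Prod>n<N. mmonom (\<Sum>j\<in>{j\<in>{..<length ss}. \<phi> j = n}. ss ! j) (y n)) / real N ^ length ss"
proof -
  have "moment (mset ss) (empirical N y) =
      (\<Prod>j<length ss. \<Sum>n<N. mmonom (ss ! j) (y n)) / real N ^ length ss"
    by (simp add: moment_mset integral_empirical prod_dividef)
  also have "(\<Prod>j<length ss. \<Sum>n<N. mmonom (ss ! j) (y n)) =
      (\<Sum>\<phi>\<in>{..<length ss} \<rightarrow>\<^sub>E {..<N}. \<Prod>j<length ss. mmonom (ss ! j) (y (\<phi> j)))"
    by (rule prod_sum_PiE) auto
  also have "\<dots> = (\<Sum>\<phi>\<in>{..<length ss} \<rightarrow>\<^sub>E {..<N}.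
        \<Prod>n<N. mmonom (\<Sum>j\<in>{j\<in>{..<length ss}. \<phi> j = n}. ss ! j) (y n))"
  proof (rule sum.cong)
    fix \<phi> assume \<phi>: "\<phi> \<in> {..<length ss} \<rightarrow>\<^sub>E {..<N}"
    have "(\<Prod>n<N. mmonom (\<Sum>j\<in>{j\<in>{..<length ss}. \<phi> j = n}. ss ! j) (y n)) =
        (\<Prod>n<N. \<Prod>j\<in>{j\<in>{..<length ss}. \<phi> j = n}. mmonom (ss ! j) (y (\<phi> j)))"
      by (simp add: mmonom_sum)
    also have "\<dots> = (\<Prod>j<length ss. mmonom (ss ! j) (y (\<phi> j)))"
      using \<phi> by (intro prod.group) auto
    finally show "(\<Prod>j<length ss. mmonom (ss ! j) (y (\<phi> j))) =
        (\<Prod>n<N. mmonom (\<Sum>j\<in>{j\<in>{..<length ss}. \<phi> j = n}. ss ! j) (y n))" by simp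
  qed simp
  finally show ?thesis .
qed

text \<open>Each term of \<open>moment_empirical_expand\<close> is a product of functions of
  distinct coordinates, so its integral over the product measure factorizes. A merged factor is
  again a monomial, hence integrable because all mixed moments exist.\<close>

lemma
  assumes X: "is_distribution X"
  shows integrable_moment_sample: "integrable (sample N X) (\<lambda>y. moment \<pi> (empirical N y))"
    and resample_moment: "resample N (moment (mset ss)) X =
      (\<Sum>\<phi>\<in>{..<length ss} \<rightarrow>\<^sub>E {..<N}. moment (merge_factors N ss \<phi>) X) / real N ^ length ss"
proof -
  interpret prob_space X by (rule is_distributionD[OF X])
  interpret product_sigma_finite "\<lambda>_::nat. X" by standard
  have int: "integrable (sample N X) (\<lambda>y. \<Prod>n<N. mmonom (g n) (y n))" for g
    unfolding sample_def by (intro product_integrable_prod) (auto intro: is_distributionD[OF X])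
  obtain ss' where "\<pi> = mset ss'" by (metis ex_mset)
  then show "integrable (sample N X) (\<lambda>y. moment \<pi> (empirical N y))"
    by (auto simp: moment_empirical_expand intro!: Bochner_Integration.integrable_sum int)
  have "(\<integral>y. (\<Prod>n<N. mmonom (g n) (y n)) \<partial>sample N X) = (\<Prod>n<N. \<integral>x. mmonom (g n) x \<partial>X)" for g
    unfolding sample_def by (intro product_integral_prod) (auto intro: is_distributionD[OF X])
  then show "resample N (moment (mset ss)) X =
      (\<Sum>\<phi>\<in>{..<length ss} \<rightarrow>\<^sub>E {..<N}. moment (merge_factors N ss \<phi>) X) / real N ^ length ss"
    by (simp add: resample_def moment_empirical_expand int moment_merge_factors prob_space_axioms)
qed

text \<open>Every factor lands in exactly one sample, and the dropped multisets have size 0, so the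
  total size is unchanged.\<close>

lemma merge_factors_mpartitions:
  assumes ss: "mset ss \<in> mpartitions m" and \<phi>: "\<phi> \<in> {..<length ss} \<rightarrow>\<^sub>E {..<N}"
  shows "merge_factors N ss \<phi> \<in> mpartitions m"
proof -
  have "(\<Sum>s\<in>#filter_mset (\<lambda>s. s \<noteq> {#}) \<pi>. size s) = (\<Sum>s\<in>#\<pi>. size s)" for \<pi> :: "'a multiset multiset"
    by (induction \<pi>) auto
  then have "(\<Sum>s\<in>#merge_factors N ss \<phi>. size s) =
      (\<Sum>n<N. size (\<Sum>j\<in>{j\<in>{..<length ss}. \<phi> j = n}. ss ! j))"
    by (simp add: merge_factors_def image_mset.compositionality comp_def sum_unfold_sum_mset)
  also have "\<dots> = (\<Sum>n<N. \<Sum>j\<in>{j\<in>{..<length ss}. \<phi> j = n}. size (ss ! j))"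
    by (simp add: size_multiset_sum)
  also have "\<dots> = (\<Sum>j<length ss. size (ss ! j))"
    using \<phi> by (intro sum.group) auto
  also have "\<dots> = (\<Sum>s\<in>#mset ss. size s)"
    unfolding mset_map[symmetric] sum_mset_sum_list by (simp add: sum.list_conv_set_nth atLeast0LessThan)
  finally show ?thesis using ss by (auto simp: mpartitions_def merge_factors_def)
qed

lemma merge_factors_inj:
  assumes ss: "{#} \<notin> set ss" and \<phi>: "\<phi> \<in> {..<length ss} \<rightarrow>\<^sub>E {..<N}" and inj: "inj_on \<phi> {..<length ss}"
  shows "merge_factors N ss \<phi> = mset ss"
proof -
  define g where "g n = (\<Sum>j\<in>{j\<in>{..<length ss}. \<phi> j = n}. ss ! j)" for n
  have g: "g (\<phi> j) = ss ! j" if "j < length ss" for j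
  proof -
    have "{i\<in>{..<length ss}. \<phi> i = \<phi> j} = {j}" using inj that by (auto simp: inj_on_def)
    then show ?thesis by (simp add: g_def)
  qed
  have g0: "g n = {#} \<longleftrightarrow> n \<notin> \<phi> ` {..<length ss}" for n
  proof
    assume "n \<notin> \<phi> ` {..<length ss}"
    then have "{j\<in>{..<length ss}. \<phi> j = n} = {}" by auto
    then show "g n = {#}" by (simp only: g_def sum.empty)
  next
    assume "g n = {#}"
    then show "n \<notin> \<phi> ` {..<length ss}" using g ss by (metis imageE lessThan_iff nth_mem)
  qed
  have "merge_factors N ss \<phi> = image_mset g (filter_mset (\<lambda>n. g n \<noteq> {#}) (mset_set {..<N}))"
    unfolding merge_factors_def g_def[symmetric] by (simp add: filter_mset_image_mset)
  also have "filter_mset (\<lambda>n. g n \<noteq> {#}) (mset_set {..<N}) = mset_set (\<phi> ` {..<length ss})"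
    using \<phi> by (auto simp: filter_mset_mset_set g0 intro!: arg_cong[of _ _ mset_set])
  also have "\<dots> = image_mset \<phi> (mset_set {..<length ss})"
    by (simp add: image_mset_mset_set inj)
  also have "image_mset g \<dots> = image_mset (\<lambda>j. ss ! j) (mset_set {..<length ss})"
    by (auto simp: image_mset.compositionality g intro!: image_mset_cong)
  also have "\<dots> = mset (map (\<lambda>j. ss ! j) [0..<length ss])"
    by (simp add: atLeast0LessThan)
  finally show ?thesis by (simp add: map_nth)
qed

section \<open>Finiteness of the index sets and counting of non-injective maps\<close>

lemma finite_multisets_size_le:
  assumes "finite A"
  shows "finite {M. set_mset M \<subseteq> A \<and> size M \<le> n}"
proof -
  have "{M. set_mset M \<subseteq> A \<and> size M \<le> n} \<subseteq> mset ` {xs. set xs \<subseteq> A \<and> length xs \<le> n}"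
  proof
    fix M assume "M \<in> {M. set_mset M \<subseteq> A \<and> size M \<le> n}"
    moreover obtain xs where "M = mset xs" by (metis ex_mset)
    ultimately show "M \<in> mset ` {xs. set xs \<subseteq> A \<and> length xs \<le> n}" by auto
  qed
  then show ?thesis using finite_lists_length_le[OF assms] finite_surj by blast
qed

text \<open>Every factor has size at least 1. This lets a condition on the order \<open>m\<close>
  control the number of factors, which is what the counting of maps depends on.\<close>

lemma size_le_mpartitions:
  assumes "\<pi> \<in> mpartitions m"
  shows "size \<pi> \<le> m"
proof -
  have "{#} \<notin># \<pi> \<Longrightarrow> size \<pi> \<le> (\<Sum>s\<in>#\<pi>. size s)"
  proof (induction \<pi>)
    case (add s \<pi>)
    then have "size s \<ge> 1" by (auto simp: Suc_le_eq simp flip: nonempty_has_size)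
    then show ?case using add by auto
  qed auto
  then show ?thesis using assms by (auto simp: mpartitions_def)
qed

text \<open>Both levels are multisets of bounded size over a finite set: the factors over the index
  type, and the partition over the possible factors.\<close>

lemma finite_mpartitions: "finite (mpartitions m :: 'd::finite multiset multiset set)"
proof -
  have "mpartitions m \<subseteq> {\<pi>. set_mset \<pi> \<subseteq> {s :: 'd multiset. set_mset s \<subseteq> UNIV \<and> size s \<le> m} \<and> size \<pi> \<le> m}"
  proof
    fix \<pi> :: "'d multiset multiset" assume \<pi>: "\<pi> \<in> mpartitions m"
    have "size s \<le> m" if "s \<in># \<pi>" for s
    proof -
      obtain \<rho> where "\<pi> = add_mset s \<rho>" using \<open>s \<in># \<pi>\<close> by (metis mset_add)
      then show ?thesis using \<pi> by (auto simp: mpartitions_def)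
    qed
    then show "\<pi> \<in> {\<pi>. set_mset \<pi> \<subseteq> {s. set_mset s \<subseteq> UNIV \<and> size s \<le> m} \<and> size \<pi> \<le> m}"
      using size_le_mpartitions[OF \<pi>] by auto
  qed
  then show ?thesis
    by (rule finite_subset) (intro finite_multisets_size_le finite)
qed

text \<open>There are \<open>N (N - 1) \<dots> (N - n + 1)\<close> injective maps, at least
  \<open>(N - n) ^ n = N ^ n * (1 - n / N) ^ n\<close>. By Bernoulli this is at least
  \<open>N ^ n * (1 - n\<^sup>2 / N)\<close>, hence at least 7/8 of all maps if
  \<open>8 * n\<^sup>2 \<le> N\<close>.\<close>

lemma card_not_inj_on_le:
  fixes N n :: nat
  shows "real (card {\<phi> \<in> {..<n} \<rightarrow>\<^sub>E {..<N}. \<not> inj_on \<phi> {..<n}}) \<le> real N ^ n"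
    and "8 * n\<^sup>2 \<le> N \<Longrightarrow>
      real (card {\<phi> \<in> {..<n} \<rightarrow>\<^sub>E {..<N}. \<not> inj_on \<phi> {..<n}}) \<le> real N ^ n / 8"
proof -
  let ?E = "{..<n} \<rightarrow>\<^sub>E {..<N}"
  have fin: "finite ?E" by (simp add: finite_PiE)
  have cE: "card ?E = N ^ n" by (simp add: card_funcsetE)
  show "real (card {\<phi> \<in> ?E. \<not> inj_on \<phi> {..<n}}) \<le> real N ^ n"
  proof -
    have "card {\<phi> \<in> ?E. \<not> inj_on \<phi> {..<n}} \<le> N ^ n"
      unfolding cE[symmetric] by (rule card_mono[OF fin]) blast
    then show ?thesis unfolding of_nat_power[symmetric] of_nat_le_iff .
  qed
  assume le: "8 * n\<^sup>2 \<le> N"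
  show "real (card {\<phi> \<in> ?E. \<not> inj_on \<phi> {..<n}}) \<le> real N ^ n / 8"
  proof (cases "n = 0")
    case False
    have "n \<le> n\<^sup>2" by (simp add: power2_eq_square)
    \<comment> \<open>The bound \<open>n \<le> N\<close> makes the truncated subtraction
      \<open>N - n\<close> exact and gives \<open>- n / N \<ge> -1\<close>, as Bernoulli
      requires.\<close>
    then have N: "N > 0" "n \<le> N" using le False by linarith+
    have "8 * (real n * real n) \<le> real N"
      using le unfolding power2_eq_square by (metis of_nat_le_iff of_nat_mult of_nat_numeral)
    then have "real n * real n / real N \<le> 1 / 8" using N by (simp add: pos_divide_le_eq)
    then have "1 - 1/8 \<le> 1 + real n * (- real n / real N)" by simp
    then have "real N ^ n * (1 - 1/8) \<le> real N ^ n * (1 + real n * (- real n / real N))"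
      by (rule mult_left_mono) simp
    also have "\<dots> \<le> real N ^ n * (1 + - real n / real N) ^ n"
      using N by (intro mult_left_mono Bernoulli_inequality) (auto simp: pos_le_divide_eq)
    also have "\<dots> = (\<Prod>i<n. real (N - n))"
    proof -
      have "1 + - real n / real N = real (N - n) / real N"
        using N by (simp add: of_nat_diff diff_divide_distrib)
      then show ?thesis using N by (simp add: power_divide)
    qed
    also have "\<dots> \<le> (\<Prod>i<n. real (N - i))"
      by (intro prod_mono) auto
    also have "\<dots> = real (card {\<phi> \<in> ?E. inj_on \<phi> {..<n}})"
      by (subst card_inj_on_subset_funcset) (auto simp: atLeast0LessThan)
    finally have "real N ^ n * (7/8) \<le> real (card {\<phi> \<in> ?E. inj_on \<phi> {..<n}})" by simp
    moreover have "real N ^ n =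
        real (card {\<phi> \<in> ?E. inj_on \<phi> {..<n}}) + real (card {\<phi> \<in> ?E. \<not> inj_on \<phi> {..<n}})"
    proof -
      have "card ({\<phi> \<in> ?E. inj_on \<phi> {..<n}} \<union> {\<phi> \<in> ?E. \<not> inj_on \<phi> {..<n}}) =
          card {\<phi> \<in> ?E. inj_on \<phi> {..<n}} + card {\<phi> \<in> ?E. \<not> inj_on \<phi> {..<n}}"
        by (rule card_Un_disjoint; (rule finite_subset[OF _ fin])?) blast+
      also have "{\<phi> \<in> ?E. inj_on \<phi> {..<n}} \<union> {\<phi> \<in> ?E. \<not> inj_on \<phi> {..<n}} = ?E" by blast
      finally show ?thesis unfolding cE of_nat_power[symmetric] of_nat_add[symmetric] by (rule arg_cong)
    qed
    ultimately show ?thesis by simp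
  qed auto
qed

subsection \<open>Combinations of moments of a fixed order\<close>

text \<open>A single factor of size \<open>m\<close> is a witness, except for \<open>m = 0\<close>,
  where it would be empty. Thus the maximum in \<open>alpha\<close> is over a nonempty set.\<close>

lemma mpartitions_nonempty: "mpartitions m \<noteq> {}"
proof -
  have "(if m = 0 then {#} else {#replicate_mset m undefined#}) \<in> mpartitions m"
    by (auto simp: mpartitions_def)
  then show ?thesis by blast
qed

lemma abs_moment_le_alpha:
  assumes "\<pi> \<in> mpartitions m"
  shows "\<bar>moment \<pi> X\<bar> \<le> alpha X m"
  unfolding alpha_def using assms by (intro Max_ge) (auto simp: finite_mpartitions)

lemma alpha_nonneg: "0 \<le> alpha X m"
proof -
  obtain \<pi> :: "'a multiset multiset" where "\<pi> \<in> mpartitions m" using mpartitions_nonempty by blast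
  then show ?thesis using abs_moment_le_alpha[of \<pi> m X] by linarith
qed

lemma beta_nonneg: "0 \<le> beta f m"
  unfolding beta_def by (intro sum_nonneg) auto

text \<open>The coefficients do not depend on the distribution, so the representation survives being
  evaluated at random empirical measures. \<open>B\<close> only bounds their
  \<open>l\<^sup>1\<close> norm, which lets estimates be composed without tracking the
  coefficients.\<close>

definition moment_comb :: "nat \<Rightarrow> real \<Rightarrow> ((real ^ 'd::finite) measure \<Rightarrow> real) \<Rightarrow> bool" where
  "moment_comb m B G \<longleftrightarrow> (\<exists>c. (\<Sum>\<pi>\<in>mpartitions m. \<bar>c \<pi>\<bar>) \<le> B \<and>
     (\<forall>X. is_distribution X \<longrightarrow> G X = (\<Sum>\<pi>\<in>mpartitions m. c \<pi> * moment \<pi> X)))"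

lemma moment_combI:
  assumes "(\<Sum>\<pi>\<in>mpartitions m. \<bar>c \<pi>\<bar>) \<le> B"
    and "\<And>X. is_distribution X \<Longrightarrow> G X = (\<Sum>\<pi>\<in>mpartitions m. c \<pi> * moment \<pi> X)"
  shows "moment_comb m B G"
  using assms by (auto simp: moment_comb_def)

lemma moment_combE:
  assumes "moment_comb m B G"
  obtains c where "(\<Sum>\<pi>\<in>mpartitions m. \<bar>c \<pi>\<bar>) \<le> B"
    and "\<And>X. is_distribution X \<Longrightarrow> G X = (\<Sum>\<pi>\<in>mpartitions m. c \<pi> * moment \<pi> X)"
  using assms by (auto simp: moment_comb_def)

lemma moment_comb_mono: "moment_comb m B G \<Longrightarrow> B \<le> B' \<Longrightarrow> moment_comb m B' G"
  unfolding moment_comb_def using order_trans by blast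

lemma moment_comb_cong:
  assumes "moment_comb m B G" "\<And>X. is_distribution X \<Longrightarrow> H X = G X"
  shows "moment_comb m B H"
  using assms by (auto simp: moment_comb_def)

lemma moment_comb_moment:
  assumes "\<pi> \<in> mpartitions m"
  shows "moment_comb m 1 (moment \<pi>)"
  using assms
  by (intro moment_combI[where c = "\<lambda>\<rho>. if \<rho> = \<pi> then 1 else 0"])
     (auto simp: if_distrib[where f = abs] if_distrib[where f = "\<lambda>x. x * _"] finite_mpartitions cong: if_cong)

lemma moment_comb_zero: "moment_comb m 0 (\<lambda>X. 0)"
  by (intro moment_combI[where c = "\<lambda>_. 0"]) auto

lemma moment_comb_add:
  assumes "moment_comb m B G" "moment_comb m C H"
  shows "moment_comb m (B + C) (\<lambda>X. G X + H X)"
proof -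
  from assms(1) obtain b where b: "(\<Sum>\<pi>\<in>mpartitions m. \<bar>b \<pi>\<bar>) \<le> B"
    "\<And>X. is_distribution X \<Longrightarrow> G X = (\<Sum>\<pi>\<in>mpartitions m. b \<pi> * moment \<pi> X)" by (rule moment_combE) blast
  from assms(2) obtain c where c: "(\<Sum>\<pi>\<in>mpartitions m. \<bar>c \<pi>\<bar>) \<le> C"
    "\<And>X. is_distribution X \<Longrightarrow> H X = (\<Sum>\<pi>\<in>mpartitions m. c \<pi> * moment \<pi> X)" by (rule moment_combE) blast
  have "(\<Sum>\<pi>\<in>mpartitions m. \<bar>b \<pi> + c \<pi>\<bar>) \<le> (\<Sum>\<pi>\<in>mpartitions m. \<bar>b \<pi>\<bar> + \<bar>c \<pi>\<bar>)"
    by (intro sum_mono abs_triangle_ineq)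
  also have "\<dots> \<le> B + C" using b(1) c(1) by (simp add: sum.distrib)
  finally show ?thesis
    by (intro moment_combI[where c = "\<lambda>\<pi>. b \<pi> + c \<pi>"]) (auto simp: b c distrib_right sum.distrib)
qed

lemma moment_comb_scale:
  assumes "moment_comb m B G"
  shows "moment_comb m (\<bar>a\<bar> * B) (\<lambda>X. a * G X)"
proof -
  from assms obtain b where b: "(\<Sum>\<pi>\<in>mpartitions m. \<bar>b \<pi>\<bar>) \<le> B"
    "\<And>X. is_distribution X \<Longrightarrow> G X = (\<Sum>\<pi>\<in>mpartitions m. b \<pi> * moment \<pi> X)" by (rule moment_combE) blast
  then show ?thesis
    by (intro moment_combI[where c = "\<lambda>\<pi>. a * b \<pi>"])
       (auto simp: abs_mult mult.assoc mult_left_mono simp flip: sum_distrib_left)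
qed

lemma moment_comb_sum:
  assumes "\<And>i. i \<in> I \<Longrightarrow> moment_comb m (B i) (G i)"
  shows "moment_comb m (\<Sum>i\<in>I. B i) (\<lambda>X. \<Sum>i\<in>I. G i X)"
  using assms
  by (induction I rule: infinite_finite_induct) (auto intro: moment_comb_zero moment_comb_add)

text \<open>The pairing of \<open>l\<^sup>1\<close> with the maximum norm: a coefficient bound,
  uniform over distributions, becomes a bound at a given \<open>X\<close>.\<close>

lemma moment_comb_abs_le:
  assumes "moment_comb m B G" "is_distribution X"
  shows "\<bar>G X\<bar> \<le> B * alpha X m"
proof -
  from assms(1) obtain b where b: "(\<Sum>\<pi>\<in>mpartitions m. \<bar>b \<pi>\<bar>) \<le> B"
    "\<And>X. is_distribution X \<Longrightarrow> G X = (\<Sum>\<pi>\<in>mpartitions m. b \<pi> * moment \<pi> X)" by (rule moment_combE) blast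
  have "\<bar>G X\<bar> \<le> (\<Sum>\<pi>\<in>mpartitions m. \<bar>b \<pi>\<bar> * \<bar>moment \<pi> X\<bar>)"
    unfolding b(2)[OF assms(2)] abs_mult[symmetric] by (rule sum_abs)
  also have "\<dots> \<le> (\<Sum>\<pi>\<in>mpartitions m. \<bar>b \<pi>\<bar>) * alpha X m"
    unfolding sum_distrib_right by (intro sum_mono mult_left_mono abs_moment_le_alpha) auto
  also have "\<dots> \<le> B * alpha X m" by (intro mult_right_mono b alpha_nonneg)
  finally show ?thesis .
qed

lemma integrable_moment_comb_sample:
  assumes "moment_comb m B G" "is_distribution X" "N \<ge> 1"
  shows "integrable (sample N X) (\<lambda>y. G (empirical N y))"
proof -
  from assms(1) obtain b where
    b: "\<And>X. is_distribution X \<Longrightarrow> G X = (\<Sum>\<pi>\<in>mpartitions m. b \<pi> * moment \<pi> X)" by (rule moment_combE) blast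
  show ?thesis
    unfolding b[OF is_distribution_empirical[OF assms(3)]]
    by (intro Bochner_Integration.integrable_sum integrable_mult_right integrable_moment_sample assms)
qed

text \<open>The norm bound for \<open>Id - S\<close> on moments of order \<open>m\<close>.\<close>

definition bias_factor :: "nat \<Rightarrow> nat \<Rightarrow> real" where
  "bias_factor N m = (if 8 * m\<^sup>2 \<le> N then 1 / 4 else 2)"

lemma bias_factor_nonneg: "0 \<le> bias_factor N m"
  by (simp add: bias_factor_def)

text \<open>\<open>Id - S\<close> sends a moment to the average, over all maps, of its difference
  from the merged moment. Injective maps contribute 0 and any other map contributes coefficients of
  norm at most 2.\<close>

lemma moment_comb_id_minus_resample_moment:
  assumes \<pi>: "\<pi> \<in> mpartitions m" and N: "N \<ge> 1"
  shows "moment_comb m (bias_factor N m) (id_minus_resample N (moment \<pi>))"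
proof -
  obtain ss where ss: "\<pi> = mset ss" by (metis ex_mset)
  define n where "n = length ss"
  define E where "E = {..<n} \<rightarrow>\<^sub>E {..<N}"
  define E' where "E' = {\<phi>\<in>E. \<not> inj_on \<phi> {..<n}}"
  \<comment> \<open>Twice the proportion of non-injective maps, hence at most 2 in general and at
    most 2 * 1/8 = 1/4 when \<open>8 * m\<^sup>2 \<le> N\<close>.\<close>
  define q where "q = (\<Sum>\<phi>\<in>E'. (1 + 1 :: real)) / real N ^ n"
  have fin: "finite E" unfolding E_def by (simp add: finite_PiE)
  have cE: "real (card E) = real N ^ n" by (simp add: E_def card_funcsetE)
  have nz: "real N ^ n \<noteq> 0" using N by simp
  have "n \<le> m" using size_le_mpartitions[OF \<pi>] by (simp add: ss n_def)
  then have "8 * n\<^sup>2 \<le> N" if "8 * m\<^sup>2 \<le> N"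
    using that power_mono[of n m 2] by linarith
  then have "q \<le> bias_factor N m"
    using card_not_inj_on_le[of n N] N
    by (auto simp: q_def E'_def E_def bias_factor_def divide_simps)
  moreover have "moment_comb m q (id_minus_resample N (moment \<pi>))"
  proof (rule moment_comb_cong)
    have "moment_comb m (\<Sum>\<phi>\<in>E'. 1 + 1) (\<lambda>X. \<Sum>\<phi>\<in>E'. moment \<pi> X + (-1) * moment (merge_factors N ss \<phi>) X)"
    proof (intro moment_comb_sum moment_comb_add moment_comb_moment \<pi>)
      fix \<phi> assume "\<phi> \<in> E'"
      then have "merge_factors N ss \<phi> \<in> mpartitions m"
        using \<pi> by (intro merge_factors_mpartitions) (auto simp: ss E'_def E_def n_def)
      from moment_comb_scale[OF moment_comb_moment[OF this], of "-1"]
      show "moment_comb m 1 (\<lambda>X. (-1) * moment (merge_factors N ss \<phi>) X)" by simp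
    qed
    from moment_comb_scale[OF this, of "1 / real N ^ n"]
    show "moment_comb m q
        (\<lambda>X. 1 / real N ^ n * (\<Sum>\<phi>\<in>E'. moment \<pi> X + (-1) * moment (merge_factors N ss \<phi>) X))"
      by (simp add: q_def)
  next
    fix X :: "(real ^ 'a) measure" assume X: "is_distribution X"
    have "(\<Sum>\<phi>\<in>E. moment \<pi> X - moment (merge_factors N ss \<phi>) X) =
        (\<Sum>\<phi>\<in>E'. moment \<pi> X - moment (merge_factors N ss \<phi>) X)"
      using fin \<pi>
      by (intro sum.mono_neutral_right)
         (auto simp: E'_def E_def n_def ss mpartitions_def
           intro!: merge_factors_inj[THEN arg_cong, of _ _ _ "\<lambda>\<rho>. moment \<rho> X", THEN sym])
    moreover have "id_minus_resample N (moment \<pi>) X =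
        (\<Sum>\<phi>\<in>E. moment \<pi> X - moment (merge_factors N ss \<phi>) X) / real N ^ n"
      using nz
      by (simp add: id_minus_resample_def ss resample_moment[OF X] sum_subtractf cE diff_divide_distrib
          flip: n_def E_def)
    ultimately show "id_minus_resample N (moment \<pi>) X =
        1 / real N ^ n * (\<Sum>\<phi>\<in>E'. moment \<pi> X + (-1) * moment (merge_factors N ss \<phi>) X)"
      by simp
  qed
  ultimately show ?thesis using moment_comb_mono by blast
qed

text \<open>Linearity: the expansion of \<open>G\<close> also holds at empirical measures, so it may
  be inserted under the integral and the finite sum integrated termwise.\<close>

lemma moment_comb_id_minus_resample:
  assumes G: "moment_comb m B G" and N: "N \<ge> 1"
  shows "moment_comb m (bias_factor N m * B) (id_minus_resample N G)"
proof -
  from G obtain b where b: "(\<Sum>\<pi>\<in>mpartitions m. \<bar>b \<pi>\<bar>) \<le> B"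
    "\<And>X. is_distribution X \<Longrightarrow> G X = (\<Sum>\<pi>\<in>mpartitions m. b \<pi> * moment \<pi> X)" by (rule moment_combE) blast
  have "moment_comb m (\<Sum>\<pi>\<in>mpartitions m. \<bar>b \<pi>\<bar> * bias_factor N m)
      (\<lambda>X. \<Sum>\<pi>\<in>mpartitions m. b \<pi> * id_minus_resample N (moment \<pi>) X)"
    by (intro moment_comb_sum moment_comb_scale moment_comb_id_minus_resample_moment N)
  then have "moment_comb m (\<Sum>\<pi>\<in>mpartitions m. \<bar>b \<pi>\<bar> * bias_factor N m) (id_minus_resample N G)"
  proof (rule moment_comb_cong)
    fix X :: "(real ^ 'a) measure" assume X: "is_distribution X"
    have "resample N G X = (\<Sum>\<pi>\<in>mpartitions m. b \<pi> * resample N (moment \<pi>) X)"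
      unfolding resample_def b(2)[OF is_distribution_empirical[OF N]]
      by (subst Bochner_Integration.integral_sum) (auto intro: integrable_moment_sample[OF X])
    then show "id_minus_resample N G X =
        (\<Sum>\<pi>\<in>mpartitions m. b \<pi> * id_minus_resample N (moment \<pi>) X)"
      by (simp add: id_minus_resample_def b(2)[OF X] sum_subtractf right_diff_distrib)
  qed
  moreover have "(\<Sum>\<pi>\<in>mpartitions m. \<bar>b \<pi>\<bar> * bias_factor N m) \<le> bias_factor N m * B"
    using mult_right_mono[OF b(1) bias_factor_nonneg[of N m]]
    unfolding sum_distrib_right[symmetric] by (simp only: mult.commute[of B])
  ultimately show ?thesis using moment_comb_mono by blast
qed

lemma moment_comb_id_minus_resample_power:
  assumes "moment_comb m B G" "N \<ge> 1"
  shows "moment_comb m (bias_factor N m ^ n * B) ((id_minus_resample N ^^ n) G)"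
proof (induction n)
  case (Suc n)
  then show ?case using moment_comb_id_minus_resample[OF _ assms(2)] by (simp add: mult.assoc)
qed (use assms in simp)

subsection \<open>Measurability and interchange with the series\<close>

text \<open>Functionals of measures are integrated only along \<open>empirical N\<close>, so
  measurability is asked of that composite. The product of Borel algebras does not mention
  \<open>X\<close> and, by \<open>sets_sample\<close>, serves all distributions at once.\<close>

definition emp_measurable ::
    "nat \<Rightarrow> ((real ^ 'd::finite) measure \<Rightarrow> 'b::topological_space) \<Rightarrow> bool" where
  "emp_measurable N G \<longleftrightarrow> (\<lambda>y. G (empirical N y)) \<in> borel_measurable (Pi\<^sub>M {..<N} (\<lambda>_. borel))"

lemma emp_measurable_sample:
  assumes "emp_measurable N G" "is_distribution X"
  shows "(\<lambda>y. G (empirical N y)) \<in> borel_measurable (sample N X)"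
  using assms unfolding emp_measurable_def
  by (subst measurable_cong_sets[OF sets_sample[OF assms(2)] refl])

text \<open>Resampling from the empirical distribution of \<open>y\<close> is composing \<open>y\<close> with uniformly random indices.
  Hence the iterated operators are integrals against one fixed measure, which makes them measurable
  in \<open>y\<close>.\<close>

definition index_sample :: "nat \<Rightarrow> (nat \<Rightarrow> nat) measure" where
  "index_sample N = sample N (uniform_count_measure {..<N})"

lemma sample_empirical:
  fixes y :: "nat \<Rightarrow> real ^ 'd::finite"
  assumes "N \<ge> 1"
  shows "sample N (empirical N y) =
    distr (index_sample N) (Pi\<^sub>M {..<N} (\<lambda>_. borel)) (compose {..<N} y)"
proof -
  let ?U = "uniform_count_measure {..<N}" and ?E = "empirical N y"
  have sE: "sets ?E = sets borel" by (simp add: empirical_def)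
  have "y \<in> measurable ?U ?E"
    using borel_measurable_uniform_count_measure[of y N] by (simp add: measurable_cong_sets[OF refl sE])
  \<comment> \<open>Pushing forward each coordinate of a product of probability measures gives the
    product of the push-forwards.\<close>
  then have "distr (Pi\<^sub>M {..<N} (\<lambda>_. ?U)) (Pi\<^sub>M {..<N} (\<lambda>_. ?E)) (compose {..<N} y) =
      Pi\<^sub>M {..<N} (\<lambda>_. distr ?U ?E y)"
    using assms is_distributionD(1)[OF is_distribution_empirical[OF assms]]
    by (intro distr_PiM_finite_prob_space' prob_space_uniform_count_measure) auto
  moreover have "distr ?U ?E y = ?E"
    unfolding empirical_def by (intro distr_cong) auto
  moreover have "distr (Pi\<^sub>M {..<N} (\<lambda>_. ?U)) (Pi\<^sub>M {..<N} (\<lambda>_. ?E)) (compose {..<N} y) =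
      distr (Pi\<^sub>M {..<N} (\<lambda>_. ?U)) (Pi\<^sub>M {..<N} (\<lambda>_. borel)) (compose {..<N} y)"
    by (intro distr_cong sets_PiM_cong) (auto simp: sE)
  ultimately show ?thesis by (simp add: sample_def index_sample_def)
qed

text \<open>Coordinate \<open>n\<close> of the composite is \<open>y (\<phi> n)\<close>, an
  evaluation at a varying index. It is jointly measurable because the index takes only finitely many
  values.\<close>

lemma measurable_compose_index_sample:
  "(\<lambda>(y, \<phi>). compose {..<N} y \<phi>) \<in>
     Pi\<^sub>M {..<N} (\<lambda>_. borel :: (real ^ 'd::finite) measure) \<Otimes>\<^sub>M index_sample N \<rightarrow>\<^sub>M Pi\<^sub>M {..<N} (\<lambda>_. borel)"
proof -
  have "(\<lambda>p. fst p (snd p n)) \<in>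
      borel_measurable (Pi\<^sub>M {..<N} (\<lambda>_. borel :: (real ^ 'd) measure) \<Otimes>\<^sub>M index_sample N)"
    if n: "n < N" for n
  proof (rule measurable_compose_countable'[where I = "{..<N}"])
    have "(\<lambda>\<phi>. \<phi> n) \<in> measurable (index_sample N) (uniform_count_measure {..<N})"
      unfolding index_sample_def sample_def using n by (intro measurable_component_singleton) auto
    then have "(\<lambda>\<phi>. \<phi> n) \<in> measurable (index_sample N) (count_space {..<N})"
      by (simp add: measurable_cong_sets[OF refl sets_uniform_count_measure_count_space])
    then show "(\<lambda>p. snd p n) \<in> measurable
        (Pi\<^sub>M {..<N} (\<lambda>_. borel :: (real ^ 'd) measure) \<Otimes>\<^sub>M index_sample N) (count_space {..<N})"
      by (rule measurable_compose[OF measurable_snd])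
  next
    fix i assume "i \<in> {..<N}"
    then show "(\<lambda>p. fst p i) \<in>
        borel_measurable (Pi\<^sub>M {..<N} (\<lambda>_. borel :: (real ^ 'd) measure) \<Otimes>\<^sub>M index_sample N)"
      by (intro measurable_compose[OF measurable_fst] measurable_component_singleton)
  qed auto
  then show ?thesis
    unfolding compose_def case_prod_beta by (intro measurable_restrict) auto
qed

lemma measurable_compose_index:
  assumes "y \<in> space (Pi\<^sub>M {..<N} (\<lambda>_. borel :: (real ^ 'd::finite) measure))"
  shows "compose {..<N} y \<in> index_sample N \<rightarrow>\<^sub>M Pi\<^sub>M {..<N} (\<lambda>_. borel)"
  using measurable_compose[OF measurable_Pair1'[OF assms] measurable_compose_index_sample] by simp

lemma prob_space_index_sample:
  assumes "N \<ge> 1"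
  shows "prob_space (index_sample N)"
  unfolding index_sample_def sample_def
  using assms by (intro prob_space_PiM prob_space_uniform_count_measure) (auto simp: lessThan_empty_iff)

lemma emp_measurable_compose:
  assumes "emp_measurable N G"
  shows "(\<lambda>(y, \<phi>). G (empirical N (compose {..<N} y \<phi>))) \<in>
    borel_measurable (Pi\<^sub>M {..<N} (\<lambda>_. borel) \<Otimes>\<^sub>M index_sample N)"
  using measurable_compose[OF measurable_compose_index_sample assms[unfolded emp_measurable_def]]
  by (simp add: case_prod_beta)

lemma emp_measurable_nn_resample:
  assumes G: "emp_measurable N G" and N: "N \<ge> 1"
  shows "emp_measurable N (nn_resample N G)"
proof -
  interpret prob_space "index_sample N" by (rule prob_space_index_sample[OF N])
  have "(\<lambda>y. \<integral>\<^sup>+\<phi>. G (empirical N (compose {..<N} y \<phi>)) \<partial>index_sample N) \<in>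
      borel_measurable (Pi\<^sub>M {..<N} (\<lambda>_. borel))"
    by (rule borel_measurable_nn_integral[OF emp_measurable_compose[OF G]])
  also have "?this \<longleftrightarrow> emp_measurable N (nn_resample N G)"
    using G unfolding emp_measurable_def nn_resample_def sample_empirical[OF N]
    by (intro measurable_cong nn_integral_distr[symmetric] measurable_compose_index) auto
  finally show ?thesis .
qed

lemma emp_measurable_resample:
  assumes G: "emp_measurable N G" and N: "N \<ge> 1"
  shows "emp_measurable N (resample N G)"
proof -
  interpret prob_space "index_sample N" by (rule prob_space_index_sample[OF N])
  have "(\<lambda>y. \<integral>\<phi>. G (empirical N (compose {..<N} y \<phi>)) \<partial>index_sample N) \<in>
      borel_measurable (Pi\<^sub>M {..<N} (\<lambda>_. borel))"
    by (rule borel_measurable_lebesgue_integral[OF emp_measurable_compose[OF G]])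
  also have "?this \<longleftrightarrow> emp_measurable N (resample N G)"
    using G unfolding emp_measurable_def resample_def sample_empirical[OF N]
    by (intro measurable_cong integral_distr[symmetric] measurable_compose_index) auto
  finally show ?thesis .
qed

lemma emp_measurable_id_minus_resample_power:
  assumes "emp_measurable N G" "N \<ge> 1"
  shows "emp_measurable N ((id_minus_resample N ^^ n) G)"
proof (induction n)
  case (Suc n)
  then show ?case
    using emp_measurable_resample[OF Suc assms(2)]
    by (auto simp: emp_measurable_def id_minus_resample_def[abs_def])
qed (use assms in simp)

lemma emp_measurable_nn_resample_power:
  assumes "emp_measurable N G" "N \<ge> 1"
  shows "emp_measurable N ((nn_resample N ^^ n) G)"
  using assms by (induction n) (auto intro: emp_measurable_nn_resample)

text \<open>The operator \<open>Id + S\<close> on nonnegative functionals: its powers majorize those of \<open>Id - S\<close>.\<close>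

definition id_plus_resample ::
    "nat \<Rightarrow> ((real ^ 'd::finite) measure \<Rightarrow> ennreal) \<Rightarrow> (real ^ 'd) measure \<Rightarrow> ennreal" where
  "id_plus_resample N G X = G X + nn_resample N G X"

lemma emp_measurable_id_plus_resample_power:
  assumes "emp_measurable N G" "N \<ge> 1"
  shows "emp_measurable N ((id_plus_resample N ^^ n) G)"
proof (induction n)
  case (Suc n)
  then show ?case
    using emp_measurable_nn_resample[OF Suc assms(2)]
    by (auto simp: emp_measurable_def id_plus_resample_def[abs_def])
qed (use assms in simp)

lemma id_minus_resample_Suc: "(id_minus_resample N ^^ Suc n) G X =
    (id_minus_resample N ^^ n) G X - resample N ((id_minus_resample N ^^ n) G) X"
  by (simp add: id_minus_resample_def)

lemma id_plus_resample_Suc: "(id_plus_resample N ^^ Suc n) G X =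
    (id_plus_resample N ^^ n) G X + nn_resample N ((id_plus_resample N ^^ n) G) X"
  by (simp add: id_plus_resample_def)

lemma nn_resample_Suc: "(nn_resample N ^^ Suc n) G X =
    (\<integral>\<^sup>+y. (nn_resample N ^^ n) G (empirical N y) \<partial>sample N X)"
  by (simp add: nn_resample_def)

lemma nn_resample_power_add:
  assumes G: "emp_measurable N G" and H: "emp_measurable N H" and N: "N \<ge> 1"
    and X: "is_distribution X"
  shows "(nn_resample N ^^ n) (\<lambda>X. G X + H X) X = (nn_resample N ^^ n) G X + (nn_resample N ^^ n) H X"
  using X
proof (induction n arbitrary: X)
  case (Suc n)
  have "(nn_resample N ^^ Suc n) (\<lambda>X. G X + H X) X =
      (\<integral>\<^sup>+y. (nn_resample N ^^ n) G (empirical N y) + (nn_resample N ^^ n) H (empirical N y) \<partial>sample N X)"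
    unfolding nn_resample_Suc Suc.IH[OF is_distribution_empirical[OF N]] ..
  also have "\<dots> = (nn_resample N ^^ Suc n) G X + (nn_resample N ^^ Suc n) H X"
    unfolding nn_resample_Suc using Suc.prems
    by (intro nn_integral_add emp_measurable_sample emp_measurable_nn_resample_power G H N)
  finally show ?case .
qed auto

text \<open>On nonnegative functionals \<open>(Id + S) ^ n\<close> expands into a finite sum of
  powers of \<open>S\<close> up to \<open>n\<close>, each finite at \<open>X\<close> by
  assumption.\<close>

lemma id_plus_resample_power_finite:
  assumes G: "emp_measurable N G" and N: "N \<ge> 1" and X: "is_distribution X"
    and fin: "\<And>i. i \<le> K \<Longrightarrow> (nn_resample N ^^ i) G X < \<infinity>" and n: "n \<le> K"
  shows "(id_plus_resample N ^^ n) G X < \<infinity>"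
proof -
  \<comment> \<open>The extra power \<open>j\<close> replaces the binomial expansion: the induction
    step trades one factor \<open>Id + S\<close> for the powers \<open>j\<close> and
    \<open>Suc j\<close>.\<close>
  have "(nn_resample N ^^ j) ((id_plus_resample N ^^ n) G) X < \<infinity>" if "j + n \<le> K" for j
    using that
  proof (induction n arbitrary: j)
    case 0
    then show ?case using fin by simp
  next
    case (Suc n)
    let ?H = "(id_plus_resample N ^^ n) G"
    have H: "emp_measurable N ?H" by (rule emp_measurable_id_plus_resample_power[OF G N])
    have "(nn_resample N ^^ j) ((id_plus_resample N ^^ Suc n) G) X =
        (nn_resample N ^^ j) (\<lambda>X. ?H X + nn_resample N ?H X) X"
      by (simp add: id_plus_resample_def[abs_def])
    also have "\<dots> = (nn_resample N ^^ j) ?H X + (nn_resample N ^^ Suc j) ?H X"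
      by (subst nn_resample_power_add[OF H emp_measurable_nn_resample[OF H N] N X])
         (simp add: funpow_swap1)
    also have "\<dots> < \<infinity>"
      using Suc.IH[of j] Suc.IH[of "Suc j"] Suc.prems by (simp del: funpow.simps)
    finally show ?case .
  qed
  from this[of 0] show ?thesis using n by simp
qed

section \<open>Termwise resampling of absolutely convergent series\<close>

lemma summable_abs_if_nn_finite:
  fixes a :: "nat \<Rightarrow> real"
  assumes "(\<Sum>m. ennreal \<bar>a m\<bar>) < \<infinity>"
  shows "summable (\<lambda>m. \<bar>a m\<bar>)"
  using assms by (intro summable_suminf_not_top) auto

text \<open>Interchange of sum and integral by absolute convergence, with majorant \<open>A\<close>.
  The identity for \<open>G\<close> and the bound are asked only where \<open>A\<close> is finite,
  because elsewhere \<open>suminf\<close> or an inner integral may be a default value; finiteness of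
  the integral of \<open>A\<close> makes that a null set.\<close>

lemma
  fixes G :: "(real ^ 'd::finite) measure \<Rightarrow> real"
  assumes X: "is_distribution X"
    and int: "\<And>m. integrable (sample N X) (\<lambda>y. Gs m (empirical N y))"
    and G: "emp_measurable N G" and A: "emp_measurable N A"
    and series: "\<And>y. A (empirical N y) < \<infinity> \<Longrightarrow> G (empirical N y) = (\<Sum>m. Gs m (empirical N y))"
    and bound: "\<And>y. A (empirical N y) < \<infinity> \<Longrightarrow>
      (\<Sum>m. ennreal \<bar>Gs m (empirical N y)\<bar>) \<le> A (empirical N y)"
    and fin: "nn_resample N A X < \<infinity>"
  shows integrable_resample_series: "integrable (sample N X) (\<lambda>y. G (empirical N y))"
    and resample_series: "resample N G X = (\<Sum>m. resample N (Gs m) X)"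
    and resample_series_bound: "(\<Sum>m. ennreal \<bar>resample N (Gs m) X\<bar>) \<le> nn_resample N A X"
proof -
  note [measurable] = borel_measurable_integrable[OF int] emp_measurable_sample[OF G X]
    emp_measurable_sample[OF A X]
  have AE: "AE y in sample N X. A (empirical N y) < \<infinity>"
    using nn_integral_PInf_AE[OF emp_measurable_sample[OF A X]] fin
    by (auto simp: nn_resample_def less_top)
  have "(\<Sum>m. \<integral>\<^sup>+y. ennreal \<bar>Gs m (empirical N y)\<bar> \<partial>sample N X) =
      (\<integral>\<^sup>+y. (\<Sum>m. ennreal \<bar>Gs m (empirical N y)\<bar>) \<partial>sample N X)"
    by (subst nn_integral_suminf) auto
  also have "\<dots> \<le> nn_resample N A X"
    unfolding nn_resample_def by (intro nn_integral_mono_AE eventually_mono[OF AE] bound)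
  finally have le: "(\<Sum>m. \<integral>\<^sup>+y. ennreal \<bar>Gs m (empirical N y)\<bar> \<partial>sample N X) \<le> nn_resample N A X" .
  have eq: "(\<integral>\<^sup>+y. ennreal \<bar>Gs m (empirical N y)\<bar> \<partial>sample N X) =
      ennreal \<bar>\<integral>y. \<bar>Gs m (empirical N y)\<bar> \<partial>sample N X\<bar>" for m
    using int by (subst nn_integral_eq_integral) auto
  have sm: "summable (\<lambda>m. \<integral>y. norm (Gs m (empirical N y)) \<partial>sample N X)"
    using summable_abs_if_nn_finite[OF le_less_trans[OF le[unfolded eq] fin]] by simp
  have AEs: "AE y in sample N X. summable (\<lambda>m. norm (Gs m (empirical N y)))"
    using AE
  proof eventually_elim
    case (elim y)
    from summable_abs_if_nn_finite[OF le_less_trans[OF bound[OF elim] elim]] show ?case by simp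
  qed
  have AEe: "AE y in sample N X. (\<Sum>m. Gs m (empirical N y)) = G (empirical N y)"
    using AE by eventually_elim (simp add: series)
  show "integrable (sample N X) (\<lambda>y. G (empirical N y))"
    using integrable_suminf[OF int AEs sm] AEe
    by (subst integrable_cong_AE[where g = "\<lambda>y. \<Sum>m. Gs m (empirical N y)"]) auto
  have "resample N G X = (\<integral>y. (\<Sum>m. Gs m (empirical N y)) \<partial>sample N X)"
    unfolding resample_def using AEe by (intro integral_cong_AE) auto
  then show "resample N G X = (\<Sum>m. resample N (Gs m) X)"
    unfolding resample_def using integral_suminf[OF int AEs sm] by simp
  have "ennreal \<bar>resample N (Gs m) X\<bar> \<le> (\<integral>\<^sup>+y. ennreal \<bar>Gs m (empirical N y)\<bar> \<partial>sample N X)" for m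
    unfolding eq resample_def
    by (intro ennreal_leI) (metis abs_ge_self integral_abs_bound order_trans)
  then have "(\<Sum>m. ennreal \<bar>resample N (Gs m) X\<bar>) \<le>
      (\<Sum>m. \<integral>\<^sup>+y. ennreal \<bar>Gs m (empirical N y)\<bar> \<partial>sample N X)"
    by (intro suminf_le) auto
  with le show "(\<Sum>m. ennreal \<bar>resample N (Gs m) X\<bar>) \<le> nn_resample N A X" by simp
qed

text \<open>The two claims need a joint induction: the bound at level \<open>n\<close> is the
  majorant that permits the interchange at level \<open>n + 1\<close>. \<open>X\<close> varies, as
  the hypothesis is used both at \<open>X\<close> and at the empirical measures with finite
  majorant.\<close>

lemma id_minus_resample_power_series:
  fixes Gs :: "nat \<Rightarrow> (real ^ 'd::finite) measure \<Rightarrow> real"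
  assumes N: "N \<ge> 1"
    and Gs: "\<And>m. moment_comb m (B m) (Gs m)"
    and meas: "\<And>m. emp_measurable N (Gs m)"
    and X: "is_distribution X"
    and fin: "(id_plus_resample N ^^ n) (\<lambda>X. \<Sum>m. ennreal \<bar>Gs m X\<bar>) X < \<infinity>"
  shows "(id_minus_resample N ^^ n) (\<lambda>X. \<Sum>m. Gs m X) X = (\<Sum>m. (id_minus_resample N ^^ n) (Gs m) X) \<and>
    (\<Sum>m. ennreal \<bar>(id_minus_resample N ^^ n) (Gs m) X\<bar>) \<le>
      (id_plus_resample N ^^ n) (\<lambda>X. \<Sum>m. ennreal \<bar>Gs m X\<bar>) X"
  using X fin
proof (induction n arbitrary: X)
  case (Suc n)
  let ?D = "(id_minus_resample N ^^ n) (\<lambda>X. \<Sum>m. Gs m X)"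
  let ?Ds = "\<lambda>m. (id_minus_resample N ^^ n) (Gs m)"
  let ?P = "(id_plus_resample N ^^ n) (\<lambda>X. \<Sum>m. ennreal \<bar>Gs m X\<bar>)"
  have fin: "?P X < \<infinity>" "nn_resample N ?P X < \<infinity>"
    using Suc.prems(2) unfolding id_plus_resample_Suc by auto
  have int: "integrable (sample N X) (\<lambda>y. ?Ds m (empirical N y))" for m
    by (rule integrable_moment_comb_sample[OF moment_comb_id_minus_resample_power[OF Gs N] Suc.prems(1) N])
  have "emp_measurable N (\<lambda>X. \<Sum>m. Gs m X)" "emp_measurable N (\<lambda>X. \<Sum>m. ennreal \<bar>Gs m X\<bar>)"
    using meas by (auto simp: emp_measurable_def)
  then have m: "emp_measurable N ?D" "emp_measurable N ?P"
    by (auto intro: emp_measurable_id_minus_resample_power emp_measurable_id_plus_resample_power N)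
  note IH = Suc.IH[OF Suc.prems(1) fin(1)]
  note IHe = Suc.IH[OF is_distribution_empirical[OF N]]
  have S: "resample N ?D X = (\<Sum>m. resample N (?Ds m) X)"
    by (rule resample_series[OF Suc.prems(1) int m conjunct1[OF IHe] conjunct2[OF IHe] fin(2)])
  note Sb = resample_series_bound[OF Suc.prems(1) int m conjunct1[OF IHe] conjunct2[OF IHe] fin(2)]
  \<comment> \<open>Both series must converge at \<open>X\<close> itself before their difference can
    be taken termwise.\<close>
  have s1: "summable (\<lambda>m. ?Ds m X)"
    by (rule summable_rabs_cancel[OF summable_abs_if_nn_finite[OF le_less_trans[OF conjunct2[OF IH] fin(1)]]])
  have s2: "summable (\<lambda>m. resample N (?Ds m) X)"
    by (rule summable_rabs_cancel[OF summable_abs_if_nn_finite[OF le_less_trans[OF Sb fin(2)]]])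
  have "(\<Sum>m. ennreal \<bar>(id_minus_resample N ^^ Suc n) (Gs m) X\<bar>) \<le>
      (\<Sum>m. ennreal \<bar>?Ds m X\<bar> + ennreal \<bar>resample N (?Ds m) X\<bar>)"
    unfolding id_minus_resample_Suc
    by (intro suminf_le) (auto simp flip: ennreal_plus intro!: ennreal_leI)
  also have "\<dots> = (\<Sum>m. ennreal \<bar>?Ds m X\<bar>) + (\<Sum>m. ennreal \<bar>resample N (?Ds m) X\<bar>)"
    by (intro suminf_add[symmetric]) auto
  also have "\<dots> \<le> (id_plus_resample N ^^ Suc n) (\<lambda>X. \<Sum>m. ennreal \<bar>Gs m X\<bar>) X"
    unfolding id_plus_resample_Suc by (rule add_mono[OF conjunct2[OF IH] Sb])
  finally have "(\<Sum>m. ennreal \<bar>(id_minus_resample N ^^ Suc n) (Gs m) X\<bar>) \<le>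
      (id_plus_resample N ^^ Suc n) (\<lambda>X. \<Sum>m. ennreal \<bar>Gs m X\<bar>) X" .
  moreover have "(id_minus_resample N ^^ Suc n) (\<lambda>X. \<Sum>m. Gs m X) X =
      (\<Sum>m. (id_minus_resample N ^^ Suc n) (Gs m) X)"
    unfolding id_minus_resample_Suc S conjunct1[OF IH] by (rule suminf_diff[OF s1 s2])
  ultimately show ?case by blast
qed simp

text \<open>One power more is assumed finite than the level \<open>n\<close> concerned:
  \<open>Suc n\<close> contains the resampled majorant of level \<open>n\<close>, whose finiteness
  gives integrability.\<close>

lemma integrable_id_minus_resample_power_series:
  fixes Gs :: "nat \<Rightarrow> (real ^ 'd::finite) measure \<Rightarrow> real"
  assumes N: "N \<ge> 1"
    and Gs: "\<And>m. moment_comb m (B m) (Gs m)"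
    and meas: "\<And>m. emp_measurable N (Gs m)"
    and X: "is_distribution X"
    and fin: "(id_plus_resample N ^^ Suc n) (\<lambda>X. \<Sum>m. ennreal \<bar>Gs m X\<bar>) X < \<infinity>"
  shows "integrable (sample N X) (\<lambda>y. (id_minus_resample N ^^ n) (\<lambda>X. \<Sum>m. Gs m X) (empirical N y))"
proof -
  have "emp_measurable N (\<lambda>X. \<Sum>m. Gs m X)" "emp_measurable N (\<lambda>X. \<Sum>m. ennreal \<bar>Gs m X\<bar>)"
    using meas by (auto simp: emp_measurable_def)
  then have m: "emp_measurable N ((id_minus_resample N ^^ n) (\<lambda>X. \<Sum>m. Gs m X))"
      "emp_measurable N ((id_plus_resample N ^^ n) (\<lambda>X. \<Sum>m. ennreal \<bar>Gs m X\<bar>))"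
    by (auto intro: emp_measurable_id_minus_resample_power emp_measurable_id_plus_resample_power N)
  have int: "integrable (sample N X) (\<lambda>y. (id_minus_resample N ^^ n) (Gs m) (empirical N y))" for m
    by (rule integrable_moment_comb_sample[OF moment_comb_id_minus_resample_power[OF Gs N] X N])
  note series = id_minus_resample_power_series[OF N Gs meas is_distribution_empirical[OF N]]
  show ?thesis
    using fin unfolding id_plus_resample_Suc
    by (intro integrable_resample_series[OF X int m conjunct1[OF series] conjunct2[OF series]]) auto
qed

subsection \<open>The bias bound\<close>

definition moment_term ::
    "('d multiset multiset \<Rightarrow> real) \<Rightarrow> nat \<Rightarrow> (real ^ 'd::finite) measure \<Rightarrow> real" where
  "moment_term f m X = (\<Sum>\<pi>\<in>mpartitions m. moment \<pi> X * f \<pi>)"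

lemma moment_series_eq: "moment_series f = (\<lambda>X. \<Sum>m. moment_term f m X)"
  by (simp add: moment_series_def moment_term_def fun_eq_iff)

lemma abs_moment_series_eq: "abs_moment_series f = (\<lambda>X. \<Sum>m. ennreal \<bar>moment_term f m X\<bar>)"
  by (simp add: abs_moment_series_def moment_term_def fun_eq_iff)

lemma moment_comb_moment_term: "moment_comb m (beta f m) (moment_term f m)"
  by (intro moment_combI[where c = f]) (auto simp: beta_def moment_term_def mult.commute)

lemma emp_measurable_moment: "emp_measurable N (moment \<pi>)"
proof -
  have [measurable]: "(\<lambda>y. mmonom s (y n)) \<in> borel_measurable (Pi\<^sub>M {..<N} (\<lambda>_. borel))"
    if "n < N" for n s
    using that by (intro measurable_compose[OF _ borel_measurable_mmonom] measurable_component_singleton) auto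
  show ?thesis
    unfolding emp_measurable_def moment_empirical
    by (induction \<pi>) auto
qed

lemma emp_measurable_moment_term: "emp_measurable N (moment_term f m)"
  using emp_measurable_moment unfolding emp_measurable_def moment_term_def
  by (intro borel_measurable_sum borel_measurable_times) auto

text \<open>Since \<open>S = Id - (Id - S)\<close>, applying \<open>S\<close> to the sum of the
  powers of \<open>Id - S\<close> telescopes. Integrability of each summand is what allows the
  Bochner integral to be split.\<close>

lemma bootstrap_bias_eq:
  assumes int: "\<And>i. i \<le> k \<Longrightarrow>
    integrable (sample N X) (\<lambda>y. (id_minus_resample N ^^ i) F (empirical N y))"
  shows "bootstrap_bias N k F X = - (id_minus_resample N ^^ (k + 1)) F X"
proof -
  have "(\<integral>y. iterated_bootstrap N k F (empirical N y) \<partial>sample N X) =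
      (\<Sum>i\<le>k. resample N ((id_minus_resample N ^^ i) F) X)"
    unfolding iterated_bootstrap_def resample_def using int by (intro Bochner_Integration.integral_sum) auto
  also have "\<dots> = (\<Sum>i\<le>k. (id_minus_resample N ^^ i) F X - (id_minus_resample N ^^ Suc i) F X)"
    unfolding id_minus_resample_Suc by simp
  also have "\<dots> = F X - (id_minus_resample N ^^ (k + 1)) F X"
    by (subst sum_telescope) simp
  finally show ?thesis by (simp add: bootstrap_bias_def)
qed

text \<open>With \<open>r = sqrt (g0 / gM)\<close> the choice of \<open>k\<close> says \<open>2 ^ k \<le> r < 2 ^ (k + 1)\<close>.\<close>

lemma bootstrap_bound_balance:
  fixes g0 gM :: real
  assumes gM: "0 < gM" and le: "gM \<le> g0"
    and k: "int k = \<lfloor>1 / 2 * log 2 g0 - 1 / 2 * log 2 gM\<rfloor>"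
  shows "(1 / 4) ^ (k + 1) * g0 + 2 ^ (k + 1) * gM \<le> sqrt (16 * g0 * gM)"
proof -
  have g0: "g0 > 0" using assms by simp
  define r where "r = sqrt (g0 / gM)"
  have r: "r > 0" "r\<^sup>2 = g0 / gM" using g0 gM by (auto simp: r_def)
  have "log 2 r = 1 / 2 * log 2 g0 - 1 / 2 * log 2 gM"
    using g0 gM by (simp add: r_def log_def ln_sqrt ln_div field_simps)
  then have "real k \<le> log 2 r" "log 2 r < real (k + 1)"
    using k by linarith+
  then have k1: "2 ^ k \<le> r" and k2: "r < 2 ^ (k + 1)"
    using r(1) by (simp_all add: le_log_iff log_less_iff powr_realpow powr_add)
  have gr: "g0 = r\<^sup>2 * gM" using r gM by simp
  have "r\<^sup>2 \<le> (2 ^ (k + 1))\<^sup>2" using k2 r(1) by (intro power_mono) auto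
  then have "r\<^sup>2 \<le> 4 ^ (k + 1)" by (simp only: power2_eq_square flip: power_mult_distrib) simp
  then have "(1 / 4) ^ (k + 1) * r\<^sup>2 \<le> 1" by (simp add: power_divide divide_simps)
  moreover have "1 \<le> r"
    using k1 one_le_power[of "2::real" k] by linarith
  \<comment> \<open>The first term is at most 1 and the second, \<open>2 * 2 ^ k\<close>, at most
    \<open>2 * r\<close>; as \<open>1 \<le> r\<close>, the sum is below \<open>4 * r\<close>, the
    source of the constant 16 under the root.\<close>
  ultimately have "(1 / 4) ^ (k + 1) * r\<^sup>2 + 2 ^ (k + 1) \<le> 4 * r" using k1 by simp
  then have "((1 / 4) ^ (k + 1) * r\<^sup>2 + 2 ^ (k + 1)) * gM \<le> 4 * r * gM"
    using gM by (intro mult_right_mono) auto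
  also have "4 * r * gM = sqrt (16 * g0 * gM)"
    using gM r(1) by (intro real_sqrt_unique[symmetric]) (auto simp: gr power_mult_distrib power2_eq_square)
  finally show ?thesis by (simp add: gr algebra_simps)
qed

text \<open>A natural number below the ceiling of \<open>sqrt (N / 8)\<close> is below the root
  itself, so \<open>8 * m\<^sup>2 \<le> N\<close>.\<close>

lemma bias_factor_eq_quarter:
  assumes "m < nat \<lceil>sqrt (real N / 8)\<rceil>"
  shows "bias_factor N m = 1 / 4"
proof -
  have "real m < sqrt (real N / 8)" using assms by linarith
  then have "(real m)\<^sup>2 \<le> real N / 8" by (metis less_imp_le of_nat_0_le_iff real_sqrt_le_iff real_sqrt_unique)
  then have "real (8 * m\<^sup>2) \<le> real N" by simp
  then show ?thesis unfolding bias_factor_def of_nat_le_iff by simp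
qed

text \<open>The series is split at \<open>M\<close>: the factor is 1/4 on the head, which is then
  enlarged to the whole sum, and at most 2 on the tail.\<close>

lemma suminf_bias_factor_le:
  fixes w :: "nat \<Rightarrow> real"
  assumes w: "\<And>m. 0 \<le> w m" and sm: "summable w" and M: "M = nat \<lceil>sqrt (real N / 8)\<rceil>"
  shows "summable (\<lambda>m. bias_factor N m ^ n * w m)"
    and "(\<Sum>m. bias_factor N m ^ n * w m) \<le> (1 / 4) ^ n * (\<Sum>m. w m) + 2 ^ n * (\<Sum>m. w (M + m))"
proof -
  have c2: "bias_factor N m ^ n \<le> 2 ^ n" for m
    by (intro power_mono bias_factor_nonneg) (simp add: bias_factor_def)
  show S: "summable (\<lambda>m. bias_factor N m ^ n * w m)"
    by (rule summable_comparison_test'[OF summable_mult[OF sm, of "2 ^ n"], of 0])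
       (use w bias_factor_nonneg c2 in \<open>auto simp: abs_mult intro!: mult_right_mono\<close>)
  have "(\<Sum>m. bias_factor N m ^ n * w m) =
      (\<Sum>m. bias_factor N (m + M) ^ n * w (m + M)) + (\<Sum>m<M. bias_factor N m ^ n * w m)"
    by (rule suminf_split_initial_segment[OF S])
  moreover have "(\<Sum>m. bias_factor N (m + M) ^ n * w (m + M)) \<le> (\<Sum>m. 2 ^ n * w (m + M))"
    using summable_ignore_initial_segment[OF S, of M] summable_ignore_initial_segment[OF sm, of M] w c2
    by (intro suminf_le summable_mult mult_right_mono)
  moreover have "(\<Sum>m<M. bias_factor N m ^ n * w m) = (1 / 4) ^ n * (\<Sum>m<M. w m)"
    unfolding sum_distrib_left M by (intro sum.cong refl) (subst bias_factor_eq_quarter, simp_all)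
  moreover have "(\<Sum>m<M. w m) \<le> (\<Sum>m. w m)"
    using w sm by (intro sum_le_suminf) auto
  then have "(1 / 4) ^ n * (\<Sum>m<M. w m) \<le> (1 / 4) ^ n * (\<Sum>m. w m)" by (intro mult_left_mono) auto
  moreover have "(\<Sum>m. 2 ^ n * w (m + M)) = 2 ^ n * (\<Sum>m. w (M + m))"
    using suminf_mult[OF summable_ignore_initial_segment[OF sm, of M], of "2 ^ n"] by (simp add: add.commute)
  ultimately show "(\<Sum>m. bias_factor N m ^ n * w m) \<le>
      (1 / 4) ^ n * (\<Sum>m. w m) + 2 ^ n * (\<Sum>m. w (M + m))"
    by linarith
qed

text \<open>\<open>well_defined\<close> rules out default values: the series, grouped by order,
  converges absolutely under each iterated expectation involved. \<open>gamma_pos\<close> keeps both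
  logarithms proper, and the equation for \<open>int k\<close> makes the floor nonnegative.\<close>

theorem theorem5p7:
  fixes X :: "(real ^ 'd::finite) measure"
    and f :: "'d multiset multiset \<Rightarrow> real"
    and F :: "(real ^ 'd) measure \<Rightarrow> real"
    and N k M :: nat
  assumes X: "is_distribution X"
    and F: "F = moment_series f"
    and N: "N \<ge> 1"
    and M: "M = nat \<lceil>sqrt (real N / 8)\<rceil>"
    and gamma_finite: "summable (\<lambda>j. alpha X j * beta f j)"
    and gamma_pos: "gamma X f M > 0"
    and k: "int k = \<lfloor>1 / 2 * log 2 (gamma X f 0) - 1 / 2 * log 2 (gamma X f M)\<rfloor>"
    and well_defined: "\<And>i. i \<le> k + 1 \<Longrightarrow> (nn_resample N ^^ i) (abs_moment_series f) X < \<infinity>"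
  shows "\<bar>bootstrap_bias N k F X\<bar> = \<bar>(id_minus_resample N ^^ (k + 1)) F X\<bar> \<and>
         \<bar>(id_minus_resample N ^^ (k + 1)) F X\<bar> \<le> sqrt (16 * gamma X f 0 * gamma X f M)"
proof
  let ?T = "moment_term f" and ?w = "\<lambda>m. alpha X m * beta f m"
  note comb = moment_comb_moment_term[of _ f] and meas = emp_measurable_moment_term[of N f]
  have "emp_measurable N (abs_moment_series f)"
    using meas unfolding emp_measurable_def abs_moment_series_eq by measurable
  from id_plus_resample_power_finite[OF this N X well_defined]
  have fin: "(id_plus_resample N ^^ n) (\<lambda>X. \<Sum>m. ennreal \<bar>?T m X\<bar>) X < \<infinity>" if "n \<le> k + 1" for n
    using that unfolding abs_moment_series_eq by blast
  \<comment> \<open>Integrability at level \<open>i\<close> uses the majorant of level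
    \<open>Suc i\<close>, so \<open>i \<le> k\<close> is exactly what finiteness up to
    \<open>k + 1\<close> covers.\<close>
  have "integrable (sample N X) (\<lambda>y. (id_minus_resample N ^^ i) F (empirical N y))" if "i \<le> k" for i
    unfolding F moment_series_eq using that
    by (intro integrable_id_minus_resample_power_series[OF N comb meas X] fin) simp
  from bootstrap_bias_eq[OF this]
  show "\<bar>bootstrap_bias N k F X\<bar> = \<bar>(id_minus_resample N ^^ (k + 1)) F X\<bar>" by simp
  have w: "0 \<le> ?w m" for m by (intro mult_nonneg_nonneg alpha_nonneg beta_nonneg)
  have gamma: "gamma X f 0 = (\<Sum>m. ?w m)" "gamma X f M = (\<Sum>m. ?w (M + m))"
    by (simp_all add: gamma_def)
  have "gamma X f 0 = gamma X f M + (\<Sum>m<M. ?w m)"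
    unfolding gamma using suminf_split_initial_segment[OF gamma_finite, of M] by (simp add: add.commute)
  then have gamma_le: "gamma X f M \<le> gamma X f 0" using w by (simp add: sum_nonneg)
  note S = suminf_bias_factor_le[OF w gamma_finite M, of "k + 1"]
  have "\<bar>(id_minus_resample N ^^ (k + 1)) (?T m) X\<bar> \<le> bias_factor N m ^ (k + 1) * ?w m" for m
    \<comment> \<open>Regrouped so that \<open>beta f m\<close>, the coefficient norm of the
      order-\<open>m\<close> term, carries the powers of \<open>bias_factor\<close> and
      \<open>alpha X m\<close> enters last.\<close>
    unfolding mult.commute[of "alpha X m"] mult.assoc[symmetric]
    by (rule moment_comb_abs_le[OF moment_comb_id_minus_resample_power[OF comb N] X])
  then have "\<bar>\<Sum>m. (id_minus_resample N ^^ (k + 1)) (?T m) X\<bar> \<le>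
      (\<Sum>m. bias_factor N m ^ (k + 1) * ?w m)"
    unfolding real_norm_def[symmetric] by (rule norm_suminf_le[OF _ S(1)])
  also have "\<dots> \<le> (1 / 4) ^ (k + 1) * gamma X f 0 + 2 ^ (k + 1) * gamma X f M"
    unfolding gamma by (rule S(2))
  also have "\<dots> \<le> sqrt (16 * gamma X f 0 * gamma X f M)"
    by (rule bootstrap_bound_balance[OF gamma_pos gamma_le k])
  also have "(\<Sum>m. (id_minus_resample N ^^ (k + 1)) (?T m) X) = (id_minus_resample N ^^ (k + 1)) F X"
    unfolding F moment_series_eq
    by (rule id_minus_resample_power_series[OF N comb meas X fin[OF order_refl], THEN conjunct1, symmetric])
  finally show "\<bar>(id_minus_resample N ^^ (k + 1)) F X\<bar> \<le> sqrt (16 * gamma X f 0 * gamma X f M)" .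
qed

end
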